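(* Let $m,n\ge1$ and let $U\subset\mathbb B_{m,n}$ be a system of homogeneous linear tropical differential equations. Then $\mathrm{Sol}(U)\subset\mathbb B[[T]]^n$ is a semigroup, i.e. it is closed under componentwise addition in $\mathbb B[[T]]^n$ (equivalently, under componentwise union of supports).
   Context: $\mathbb B=\{0,1\}$ is the Boolean semifield ($1+1=1$), $\mathbb B[[T]]=\mathbb B[[t_1,\dots,t_m]]$ is the semiring of Boolean formal power series. Identifying a series with its support, $\mathbb B[[T]]\cong 2^{\mathbb N^m}$, with sum = union and product = Minkowski sum $A+B=\{a+b\}$. The derivation $\partial/\partial t_i$ acts by $\partial_i(S)=\{(j_1,\dots,j_i-1,\dots,j_m): (j_1,\dots,j_m)\in S,\ j_i>0\}$; for $J\in\mathbb N^m$, $\Theta(J)=\partial^{|J|}/\partial t_1^{j_1}\cdots\partial t_m^{j_m}$. $\mathbb B_{m,n}=\mathbb B[[T]][x_{i,J}: 1\le i\le n, J\in\mathbb N^m]$ is the polynomial semiring. A homogeneous linear tropical differential equation is an element $P=\sum_{i,J}\alpha_{i,J}x_{i,J}$ (finite sum, $\alpha_{i,J}\in\mathbb B[[T]]$). For $\varphi=(\varphi_1,\dots,\varphi_n)\in\mathbb B[[T]]^n$ a monomial $E_M=\prod x_{i,J}^{m_{i,J}}$ is evaluated as $E_M(\varphi)=\prod(\Theta(J)\varphi_i)^{m_{i,J}}$. For $A\subset\mathbb N^m$, the Newton polyhedron $\mathrm{New}(A)$ is the convex hull of $\{I+J: I\in A, J\in\mathbb N^m\}\subset\mathbb R_{\ge0}^m$.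 $V\mathbb B[T]$ is the quotient semiring of $\mathbb B[[T]]$ by the congruence identifying series with equal Newton polyhedra, $V:\mathbb B[[T]]\to V\mathbb B[T]$ is the quotient homomorphism, and $\oplus$ is addition in $V\mathbb B[T]$. A sum $s=a_1\oplus\dots\oplus a_k$ in $V\mathbb B[T]$ tropically vanishes if for every $i$, $s$ equals the sum obtained by omitting the $i$-th summand (the empty sum being $0$). $\varphi\in\mathbb B[[T]]^n$ is a solution of $P=\sum_Ma_ME_M\in\mathbb B_{m,n}$ if the sum $\bigoplus_MV(a_ME_M(\varphi))$ (one summand for each monomial of $P$) tropically vanishes in $V\mathbb B[T]$. $\mathrm{Sol}(P)$ is the set of solutions of $P$ and $\mathrm{Sol}(U)=\bigcap_{P\in U}\mathrm{Sol}(P)$. *)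

theory Defs
  imports "HOL-Analysis.Analysis" "HOL-Library.Poly_Mapping" "HOL-Library.Set_Algebras"
begin

(* Multi-indices in \<nat>^m are vectors nat ^ 'm with m = CARD('m) \<ge> 1; the differential variables
   x_1, ..., x_n are indexed by a second finite type 'n with n = CARD('n) \<ge> 1. *)

section \<open>Boolean formal power series\<close>

(* A series over the Boolean semifield is identified with its support. *)
typedef 'm bps = "UNIV :: (nat ^ 'm::finite) set set"
  morphisms supp Bps
  by simp

setup_lifting type_definition_bps

lemma bps_eq_iff: "A = B \<longleftrightarrow> supp A = supp B"
  by (simp add: supp_inject)

instantiation bps :: (finite) comm_semiring_1
begin

lift_definition zero_bps :: "'a bps" is "{}" .
lift_definition one_bps :: "'a bps" is "{0}" .
lift_definition plus_bps :: "'a bps \<Rightarrow> 'a bps \<Rightarrow> 'a bps" is "(\<union>)" .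

(* (+) on sets, from Set_Algebras, is the Minkowski sum. *)
lift_definition times_bps :: "'a bps \<Rightarrow> 'a bps \<Rightarrow> 'a bps" is "(+)" .

instance
proof
  fix a b c :: "'a bps"
  show "a * b * c = a * (b * c)" by transfer (simp add: add.assoc)
  show "a * b = b * a" by transfer (simp add: add.commute)
  show "1 * a = a" by transfer (simp add: set_plus_def)
  show "a + b + c = a + (b + c)" by transfer auto
  show "a + b = b + a" by transfer auto
  show "0 + a = a" by transfer auto
  show "0 * a = 0" by transfer (simp add: set_plus_def)
  show "a * 0 = 0" by transfer (simp add: set_plus_def)
  show "(a + b) * c = a * c + b * c" by transfer (auto simp: set_plus_def)
  show "(0::'a bps) \<noteq> 1" by transfer simp
qed

end

lift_definition pd :: "'m::finite \<Rightarrow> 'm bps \<Rightarrow> 'm bps"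
  is "\<lambda>i S. {J - axis i 1 | J. J \<in> S \<and> J $ i > 0}" .

(* \<Theta>(J): each pd i is applied J $ i times. The order is irrelevant since partial derivatives commute
   (pd_commute), so the fold is well defined. *)
definition Theta :: "nat ^ 'm \<Rightarrow> 'm::finite bps \<Rightarrow> 'm bps" where
  "Theta J A = Finite_Set.fold (\<lambda>i. pd i ^^ (J $ i)) A UNIV"

lemma supp_pd:
  fixes A :: "'m::finite bps"
  shows "supp (pd i A) = {K. K + axis i 1 \<in> supp A}"
proof -
  have 1: "J - axis i 1 + axis i 1 = J" if "J $ i > 0" for J :: "nat ^ 'm"
    using that by (auto simp: vec_eq_iff axis_def)
  have 2: "(K + axis i 1) - axis i 1 = K" "(K + axis i 1) $ i > 0" for K :: "nat ^ 'm"
    by (auto simp: vec_eq_iff axis_def)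
  show ?thesis
  proof (rule set_eqI)
    fix K
    have "K \<in> supp (pd i A) \<longleftrightarrow> (\<exists>J. K = J - axis i 1 \<and> J \<in> supp A \<and> J $ i > 0)"
      by (simp add: pd.rep_eq)
    also have "\<dots> \<longleftrightarrow> K + axis i 1 \<in> supp A"
    proof
      assume "\<exists>J. K = J - axis i 1 \<and> J \<in> supp A \<and> J $ i > 0"
      then show "K + axis i 1 \<in> supp A" using 1 by auto
    next
      assume "K + axis i 1 \<in> supp A"
      then show "\<exists>J. K = J - axis i 1 \<and> J \<in> supp A \<and> J $ i > 0"
        by (intro exI[of _ "K + axis i 1"]) (simp only: 2 simp_thms)
    qed
    finally show "K \<in> supp (pd i A) \<longleftrightarrow> K \<in> {K. K + axis i 1 \<in> supp A}" by simp
  qed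
qed

lemma pd_commute: "pd i (pd j A) = pd j (pd i A)"
  by (simp add: bps_eq_iff supp_pd ac_simps)

lemma comp_fun_commute_pd: "comp_fun_commute (\<lambda>i :: 'm::finite. pd i ^^ (J $ i))"
proof -
  interpret comp_fun_commute "pd :: 'm \<Rightarrow> _"
    by standard (simp add: fun_eq_iff pd_commute)
  show ?thesis
    by (rule comp_fun_commute_funpow)
qed

lemma supp_pd_funpow:
  fixes A :: "'m::finite bps"
  shows "supp ((pd i ^^ k) A) = {K. K + axis i k \<in> supp A}"
proof (induction k)
  case 0
  have "axis i (0::nat) = (0 :: nat ^ 'm)" by (simp add: vec_eq_iff axis_def)
  then show ?case by (simp only: funpow_0 add_0_right) simp
next
  case (Suc k)
  have "axis i (Suc k) = axis i 1 + (axis i k :: nat ^ 'm)" by (simp add: vec_eq_iff axis_def)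
  then show ?case using Suc by (simp add: supp_pd add.assoc)
qed

lemma supp_Theta:
  fixes A :: "'m::finite bps"
  shows "supp (Theta J A) = {K. K + J \<in> supp A}"
proof -
  interpret comp_fun_commute "\<lambda>i. pd i ^^ (J $ i)" by (rule comp_fun_commute_pd)
  have "supp (Finite_Set.fold (\<lambda>i. pd i ^^ (J $ i)) A F) = {K. K + (\<Sum>i\<in>F. axis i (J $ i)) \<in> supp A}"
    if "finite F" for F
    using that
  proof (induction F)
    case (insert x F)
    then show ?case by (simp add: supp_pd_funpow ac_simps)
  qed simp
  moreover have "(\<Sum>i\<in>UNIV. axis i (J $ i)) = J"
    by (simp add: vec_eq_iff axis_def)
  ultimately show ?thesis by (simp add: Theta_def)
qed


section \<open>Newton polyhedra and the quotient semiring\<close>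

definition real_vec :: "nat ^ 'm \<Rightarrow> real ^ 'm::finite" where
  "real_vec I = (\<chi> i. real (I $ i))"

definition New :: "(nat ^ 'm) set \<Rightarrow> (real ^ 'm::finite) set" where
  "New A = convex hull {real_vec (I + J) | I J. I \<in> A}"

definition same_New :: "'m::finite bps \<Rightarrow> 'm bps \<Rightarrow> bool" where
  "same_New A B \<longleftrightarrow> New (supp A) = New (supp B)"

lemma New_alt: "New A = convex hull (real_vec ` (A + UNIV))"
  unfolding New_def by (rule arg_cong[where f = "\<lambda>X. convex hull X"]) (auto simp: set_plus_def)

lemma New_Un: "New (A \<union> B) = convex hull (New A \<union> New B)"
proof -
  have "(A \<union> B) + UNIV = (A + UNIV) \<union> (B + UNIV)"
    by (auto simp: set_plus_def)
  then show ?thesis by (simp add: New_alt image_Un flip: hull_Un_left hull_Un_right)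
qed

lemma New_plus: "New (A + B) = New A + New B"
proof -
  have add: "real_vec (I + J) = real_vec I + real_vec J" for I J :: "nat ^ 'a"
    by (simp add: real_vec_def vec_eq_iff)
  have image: "real_vec ` (X + Y) = real_vec ` X + real_vec ` Y" for X Y :: "(nat ^ 'a) set"
  proof
    show "real_vec ` (X + Y) \<subseteq> real_vec ` X + real_vec ` Y"
      by (auto simp: add elim!: set_plus_elim intro!: set_plus_intro)
    show "real_vec ` X + real_vec ` Y \<subseteq> real_vec ` (X + Y)"
      by (auto simp flip: add elim!: set_plus_elim intro!: imageI set_plus_intro)
  qed
  have "x \<in> UNIV + UNIV" for x :: "nat ^ 'a"
    using set_plus_intro[of 0 UNIV x UNIV] by simp
  then have UNIV: "UNIV + UNIV = (UNIV :: (nat ^ 'a) set)"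
    by blast
  have "(A + UNIV) + (B + UNIV) = (A + B) + (UNIV + UNIV)"
    by (simp only: ac_simps)
  then have "(A + B) + UNIV = (A + UNIV) + (B + UNIV)"
    by (simp only: UNIV)
  then show ?thesis
    by (simp only: New_alt image[of "A + UNIV" "B + UNIV"] convex_hull_set_plus)
qed

quotient_type 'm VB = "'m::finite bps" / same_New
  morphisms rep_VB V
  by (rule equivpI) (auto simp: same_New_def reflp_def symp_def transp_def)

(* The well-definedness obligations say that same_New is a semiring congruence. *)
instantiation VB :: (finite) comm_semiring_1
begin

lift_definition zero_VB :: "'a VB" is 0 .
lift_definition one_VB :: "'a VB" is 1 .
lift_definition plus_VB :: "'a VB \<Rightarrow> 'a VB \<Rightarrow> 'a VB" is "(+)"
  by (simp add: same_New_def plus_bps.rep_eq New_Un)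
lift_definition times_VB :: "'a VB \<Rightarrow> 'a VB \<Rightarrow> 'a VB" is "(*)"
  by (simp add: same_New_def times_bps.rep_eq New_plus)

instance
proof
  fix a b c :: "'a VB"
  show "a * b * c = a * (b * c)" by transfer (simp add: same_New_def mult.assoc)
  show "a * b = b * a" by transfer (simp add: same_New_def mult.commute)
  show "1 * a = a" by transfer (simp add: same_New_def)
  show "a + b + c = a + (b + c)" by transfer (simp add: same_New_def add.assoc)
  show "a + b = b + a" by transfer (simp add: same_New_def add.commute)
  show "0 + a = a" by transfer (simp add: same_New_def)
  show "0 * a = 0" by transfer (simp add: same_New_def)
  show "a * 0 = 0" by transfer (simp add: same_New_def)
  show "(a + b) * c = a * c + b * c" by transfer (simp add: same_New_def distrib_right)
  have "real_vec ` ((supp (1 :: 'a bps)) + UNIV) \<noteq> {}"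
    using set_plus_intro[of 0 "{0}" 0 UNIV] by (auto simp: one_bps.rep_eq)
  moreover have "real_vec ` ((supp (0 :: 'a bps)) + UNIV) = {}"
    by (auto simp: zero_bps.rep_eq elim!: set_plus_elim)
  ultimately have "\<not> same_New 0 (1 :: 'a bps)"
    unfolding same_New_def New_alt by (metis convex_hull_eq_empty)
  then show "(0::'a VB) \<noteq> 1" by transfer
qed

end

lemma V_add: "V (A + B) = V A + V B"
  by (simp add: plus_VB.abs_eq)

lemma V_mult: "V (A * B) = V A * V B"
  by (simp add: times_VB.abs_eq)

lemma V_0: "V 0 = 0" and V_1: "V 1 = 1"
  by (simp_all add: zero_VB_def one_VB_def)

lemma V_eq_iff: "V A = V B \<longleftrightarrow> New (supp A) = New (supp B)"
  by (simp add: VB.abs_eq_iff same_New_def)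

definition tropically_vanishes :: "('i \<Rightarrow> 'm::finite VB) \<Rightarrow> 'i set \<Rightarrow> bool" where
  "tropically_vanishes a K \<longleftrightarrow> (\<forall>i\<in>K. (\<Sum>k\<in>K. a k) = (\<Sum>k\<in>K - {i}. a k))"


section \<open>Differential polynomials and their solutions\<close>

(* A monomial is a finitely supported exponent function on the variables x_{i,J}, indexed by the
   pairs (i, J); a differential polynomial is a finitely supported coefficient function on monomials.
   Multiplication on both levels is the convolution product of Poly_Mapping. *)
type_synonym ('m, 'n) dmonom = "('n \<times> (nat ^ 'm)) \<Rightarrow>\<^sub>0 nat"
type_synonym ('m, 'n) dpoly = "('m, 'n) dmonom \<Rightarrow>\<^sub>0 'm bps"

definition dvar :: "'n \<Rightarrow> nat ^ 'm \<Rightarrow> ('m::finite, 'n::finite) dpoly" where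
  "dvar i J = Poly_Mapping.single (Poly_Mapping.single (i, J) 1) 1"

definition dconst :: "'m bps \<Rightarrow> ('m::finite, 'n::finite) dpoly" where
  "dconst \<alpha> = Poly_Mapping.single 0 \<alpha>"

definition homogeneous_linear :: "('m::finite, 'n::finite) dpoly \<Rightarrow> bool" where
  "homogeneous_linear P \<longleftrightarrow>
     (\<exists>F \<alpha>. finite F \<and> P = (\<Sum>(i, J)\<in>F. dconst (\<alpha> i J) * dvar i J))"

definition eval_monom :: "('m::finite, 'n::finite) dmonom \<Rightarrow> 'm bps ^ 'n \<Rightarrow> 'm bps" where
  "eval_monom M \<phi> =
     (\<Prod>(i, J)\<in>Poly_Mapping.keys M. Theta J (\<phi> $ i) ^ Poly_Mapping.lookup M (i, J))"

(* The summands are indexed by the monomials occurring in P, so that distinct monomials giving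
   equal values count as distinct summands. *)
definition is_solution :: "('m::finite, 'n::finite) dpoly \<Rightarrow> 'm bps ^ 'n \<Rightarrow> bool" where
  "is_solution P \<phi> \<longleftrightarrow>
     tropically_vanishes (\<lambda>M. V (Poly_Mapping.lookup P M * eval_monom M \<phi>)) (Poly_Mapping.keys P)"

definition Sol1 :: "('m::finite, 'n::finite) dpoly \<Rightarrow> ('m bps ^ 'n) set" where
  "Sol1 P = {\<phi>. is_solution P \<phi>}"

definition Sol :: "('m::finite, 'n::finite) dpoly set \<Rightarrow> ('m bps ^ 'n) set" where
  "Sol U = (\<Inter>P\<in>U. Sol1 P)"

end

theory Submission
  imports Defs
begin

text \<open>
  Only monomials \<open>x_{i,J}\<close> occur in a homogeneous linear equation \<open>P\<close>, and derivations are additive, so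
  each summand of \<open>P\<close> is additive in \<open>\<phi>\<close>; since \<open>V\<close> is a homomorphism, its value in the quotient
  semiring at \<open>\<phi> + \<psi>\<close> is the sum of its values at \<open>\<phi>\<close> and at \<open>\<psi>\<close>. Tropical vanishing is a family
  of equations between sums of the summands, one for each omitted index, and such equations can be
  added (\<open>tropically_vanishes_add\<close>). No geometry of Newton polyhedra is needed beyond the fact that
  \<open>V\<close> is additive.
\<close>

lemma tropically_vanishes_add:
  assumes "tropically_vanishes a K" and "tropically_vanishes b K"
  shows "tropically_vanishes (\<lambda>k. a k + b k) K"
  using assms by (simp add: tropically_vanishes_def sum.distrib)

lemma Theta_add: "Theta J (A + B) = Theta J A + Theta J B"
  by (auto simp: bps_eq_iff supp_Theta plus_bps.rep_eq)

lemma homogeneous_linear_keys: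
  assumes "homogeneous_linear P" and "M \<in> Poly_Mapping.keys P"
  obtains i J where "M = Poly_Mapping.single (i, J) 1"
proof -
  obtain F \<alpha> where "finite F" and P: "P = (\<Sum>(i, J)\<in>F. dconst (\<alpha> i J) * dvar i J)"
    using assms(1) by (auto simp: homogeneous_linear_def)
  have "Poly_Mapping.keys P \<subseteq> (\<Union>(i, J)\<in>F. Poly_Mapping.keys (dconst (\<alpha> i J) * dvar i J))"
    unfolding P using keys_sum[of "\<lambda>(i, J). dconst (\<alpha> i J) * dvar i J" F]
    by (simp add: case_prod_unfold)
  then obtain i J where "M \<in> Poly_Mapping.keys (dconst (\<alpha> i J) * dvar i J)"
    using assms(2) by auto
  then have "M = Poly_Mapping.single (i, J) 1"
    by (simp add: dconst_def dvar_def mult_single split: if_splits)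
  then show thesis by (rule that)
qed

lemma eval_monom_variable: "eval_monom (Poly_Mapping.single (i, J) 1) \<phi> = Theta J (\<phi> $ i)"
  by (simp add: eval_monom_def)

lemma is_solution_add:
  assumes "homogeneous_linear P" and "is_solution P \<phi>" and "is_solution P \<psi>"
  shows "is_solution P (\<phi> + \<psi>)"
proof -
  let ?val = "\<lambda>\<phi> M. V (Poly_Mapping.lookup P M * eval_monom M \<phi>)"
  have "?val (\<phi> + \<psi>) M = ?val \<phi> M + ?val \<psi> M" if M: "M \<in> Poly_Mapping.keys P" for M
  proof -
    obtain i J where "M = Poly_Mapping.single (i, J) 1"
      using homogeneous_linear_keys[OF assms(1) M] .
    then have "eval_monom M (\<phi> + \<psi>) = eval_monom M \<phi> + eval_monom M \<psi>"
      by (simp only: eval_monom_variable Theta_add vector_add_component)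
    then show ?thesis by (simp add: distrib_left V_add)
  qed
  then have "tropically_vanishes (?val (\<phi> + \<psi>)) (Poly_Mapping.keys P) \<longleftrightarrow>
      tropically_vanishes (\<lambda>M. ?val \<phi> M + ?val \<psi> M) (Poly_Mapping.keys P)"
    by (simp add: tropically_vanishes_def)
  then show ?thesis
    using assms(2,3) tropically_vanishes_add unfolding is_solution_def by blast
qed

theorem theorem5p4:
  fixes U :: "('m::finite, 'n::finite) dpoly set"
    and \<phi> \<psi> :: "'m bps ^ 'n"
  assumes "\<And>P. P \<in> U \<Longrightarrow> homogeneous_linear P"
    and "\<phi> \<in> Sol U" and "\<psi> \<in> Sol U"
  shows "\<phi> + \<psi> \<in> Sol U"
  using assms by (auto simp: Sol_def Sol1_def intro: is_solution_add)

end
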